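(* The set $U(3,2;\frac14)$ is comeager in the space $E(3,2;\frac14)$ (with the topology inherited from $\mathbb{R}$).
   Context: Let $(x_n)_{n\in\mathbb{N}}$ be given by $x_{2n-1}=\frac{3}{4^n}$, $x_{2n}=\frac{2}{4^n}$ for $n\in\mathbb{N}=\{1,2,\dots\}$. Then $E(3,2;\frac14)=\{\sum_{n\in A}x_n : A\subset\mathbb{N}\}$ (the Guthrie-Nymann Cantorval), and $U(3,2;\frac14)$ is the set of those $x\in E(3,2;\frac14)$ for which there is exactly one $A\subset\mathbb{N}$ with $x=\sum_{n\in A}x_n$. A set is comeager in a space if its complement in that space is meager (a countable union of nowhere dense sets). *)

theory Defs
  imports "HOL-Analysis.Analysis"
begin

definition nowhere_dense_in :: "'a topology \<Rightarrow> 'a set \<Rightarrow> bool" where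
  "nowhere_dense_in X S \<longleftrightarrow> S \<subseteq> topspace X \<and> X interior_of (X closure_of S) = {}"

definition meager_in :: "'a topology \<Rightarrow> 'a set \<Rightarrow> bool" where
  "meager_in X S \<longleftrightarrow>
    (\<exists>\<N>. countable \<N> \<and> (\<forall>N\<in>\<N>. nowhere_dense_in X N) \<and> S = \<Union>\<N>)"

definition comeager_in :: "'a topology \<Rightarrow> 'a set \<Rightarrow> bool" where
  "comeager_in X S \<longleftrightarrow> S \<subseteq> topspace X \<and> meager_in X (topspace X - S)"

text \<open>The index set of all sequences is \<open>{1..}\<close>; the value of a sequence at \<open>0\<close> is never used.
  Stating sums with \<^const>\<open>has_sum\<close> rules out the default value that \<^const>\<open>infsum\<close> takes on
  divergent sums.\<close>

definition subsums :: "(nat \<Rightarrow> real) \<Rightarrow> real set" where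
  "subsums x = {s. \<exists>A\<subseteq>{1..}. (x has_sum s) A}"

definition unique_subsums :: "(nat \<Rightarrow> real) \<Rightarrow> real set" where
  "unique_subsums x = {s \<in> subsums x. \<exists>!A. A \<subseteq> {1..} \<and> (x has_sum s) A}"

definition GN_seq :: "nat \<Rightarrow> real" where
  "GN_seq k = (if odd k then 3 / 4 ^ ((k + 1) div 2) else 2 / 4 ^ (k div 2))"

lemma GN_seq_odd: "n \<ge> 1 \<Longrightarrow> GN_seq (2 * n - 1) = 3 / 4 ^ n"
  by (simp add: GN_seq_def)

lemma GN_seq_even: "GN_seq (2 * n) = 2 / 4 ^ n"
  by (simp add: GN_seq_def)

text \<open>The Guthrie-Nymann Cantorval $E(3,2;\frac14)$ and its set of uniqueness $U(3,2;\frac14)$.\<close>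

definition GN_E :: "real set" where
  "GN_E = subsums GN_seq"

definition GN_U :: "real set" where
  "GN_U = unique_subsums GN_seq"

end

theory Submission
  imports Defs
begin

text \<open>
  Write \<open>E\<close> for the Cantorval and \<open>m\<close> for its Lebesgue measure. For every \<open>n\<close>, fixing which of the
  first \<open>2 n\<close> terms occur in a subsum splits \<open>E\<close> into \<open>4\<^sup>n\<close> cylinders, each of them a translate
  of \<open>E / 4\<^sup>n\<close> and so of measure \<open>m / 4\<^sup>n\<close>. These measures add up exactly to the measure of
  their union \<open>E\<close>, so two different cylinders of the same level overlap in a null set
  (\<open>negligible_Int_GN_cylinders\<close>).

  A point of \<open>E\<close> has several representations iff it lies in two different cylinders of some
  level. Hence the complement of the set of uniqueness is a countable union of overlaps
  (\<open>GN_E_minus_GN_U\<close>), which are compact. An overlap is nowhere dense in \<open>E\<close>: every nonempty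
  relatively open subset of \<open>E\<close> contains a cylinder, and cylinders are not null once \<open>m > 0\<close>.

  Finally, \<open>m > 0\<close> because the sums \<open>0, 2, 3, 5\<close> of subsets of \<open>{3, 2}\<close> form a complete residue
  system modulo 4. Therefore every \<open>k / 4\<^sup>n\<close> with \<open>k\<close> an integer lies in \<open>E + \<int>\<close>, and since this
  set is closed, it is the whole line (\<open>GN_E_plus_Ints\<close>), which is not a countable union of
  null sets.
\<close>

section \<open>Sets of subsums\<close>

text \<open>The set of subsums is a continuous image of the Cantor space of 0-1 sequences.\<close>

lemma compact_subsums:
  fixes x :: "nat \<Rightarrow> real"
  assumes "x summable_on UNIV"
  shows "compact (subsums x)"
proof -
  define P :: "(nat \<Rightarrow> real) set" where "P = PiE UNIV (\<lambda>_. {0, 1})"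
  \<comment> \<open>Subsums range over the indices from 1 on, so coordinate \<open>i\<close> decides about the term \<open>Suc i\<close>.\<close>
  define \<Phi> where "\<Phi> = (\<lambda>f. \<Sum>i. f i * x (Suc i))"
  have "summable (\<lambda>i. \<bar>x i\<bar>)"
    using assms summable_on_imp_summable summable_on_iff_abs_summable_on_real by fastforce
  then have summ: "summable (\<lambda>i. \<bar>x (Suc i)\<bar>)"
    by (subst summable_Suc_iff)
  have cont_partial: "continuous_on P (\<lambda>f. \<Sum>i<n. f i * x (Suc i))" for n
    by (intro continuous_intros continuous_on_subset[OF continuous_on_product_coordinates]) auto
  have "uniform_limit P (\<lambda>n f. \<Sum>i<n. f i * x (Suc i)) \<Phi> sequentially"
    unfolding \<Phi>_def
  proof (rule Weierstrass_m_test)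
    show "norm (f i * x (Suc i)) \<le> \<bar>x (Suc i)\<bar>" if "f \<in> P" for i f
    proof -
      have "f i \<in> {0, 1}" using that by (auto simp: P_def)
      then show ?thesis by auto
    qed
  qed (rule summ)
  then have "continuous_on P \<Phi>"
    by (rule uniform_limit_theorem[rotated]) (simp_all add: cont_partial)
  moreover have "compact P"
    using compactin_PiE[of "\<lambda>_::nat. euclidean :: real topology" UNIV "\<lambda>_. {0, 1}"]
    by (simp add: P_def euclidean_product_topology compactin_euclidean_iff)
  ultimately have "compact (\<Phi> ` P)"
    by (rule compact_continuous_image)
  moreover have "\<Phi> ` P = subsums x"
  proof -
    have key: "(x has_sum \<Phi> (\<lambda>i. of_bool (Suc i \<in> A))) A" if "A \<subseteq> {1..}" for A
    proof -
      let ?g = "\<lambda>i. of_bool (Suc i \<in> A) * x (Suc i)"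
      have "summable (\<lambda>i. norm (?g i))"
        by (rule summable_comparison_test'[OF summ, of 0]) auto
      then have "(?g has_sum \<Phi> (\<lambda>i. of_bool (Suc i \<in> A))) UNIV"
        unfolding \<Phi>_def
        by (rule norm_summable_imp_has_sum) (rule summable_sums, rule summable_norm_cancel, fact)
      then have "((\<lambda>i. of_bool (i \<in> A) * x i) has_sum \<Phi> (\<lambda>i. of_bool (Suc i \<in> A))) (range Suc)"
        by (subst has_sum_reindex) (auto simp: o_def)
      then show ?thesis
        by (rule has_sum_cong_neutral[THEN iffD1, rotated -1])
          (use that in \<open>auto simp: image_iff Suc_le_eq gr0_conv_Suc\<close>)
    qed
    show ?thesis
    proof (intro subset_antisym subsetI)
      fix s assume "s \<in> \<Phi> ` P"
      then obtain f where f: "f \<in> P" "s = \<Phi> f" by auto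
      have "f i = of_bool (Suc i \<in> Suc ` {i. f i = 1})" for i
      proof -
        have "f i \<in> {0, 1}" using f by (auto simp: P_def)
        then show ?thesis by auto
      qed
      then have "f = (\<lambda>i. of_bool (Suc i \<in> Suc ` {i. f i = 1}))" by blast
      moreover have "Suc ` {i. f i = 1} \<subseteq> {1..}" by auto
      ultimately have "(x has_sum s) (Suc ` {i. f i = 1})"
        using key f(2) by metis
      then show "s \<in> subsums x"
        unfolding subsums_def using \<open>Suc ` {i. f i = 1} \<subseteq> {1..}\<close> by blast
    next
      fix s assume "s \<in> subsums x"
      then obtain A where A: "A \<subseteq> {1..}" "(x has_sum s) A" by (auto simp: subsums_def)
      then have "s = \<Phi> (\<lambda>i. of_bool (Suc i \<in> A))"
        using key has_sum_unique by blast
      then show "s \<in> \<Phi> ` P"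
        by (intro image_eqI) (auto simp: P_def)
    qed
  qed
  ultimately show ?thesis by simp
qed

section \<open>Cylinders of the Cantorval\<close>

lemma GN_seq_le: "GN_seq k \<le> 3 * (1 / 2) ^ k"
proof (cases "odd k")
  case True
  then obtain m where "k = 2 * m + 1" by (auto elim: oddE)
  moreover have "(2::real) ^ (2 * m) = 4 ^ m" by (simp add: power_mult)
  ultimately show ?thesis by (simp add: GN_seq_def field_simps)
next
  case False
  then obtain m where "k = 2 * m" by (auto elim: evenE)
  moreover have "(2::real) ^ (2 * m) = 4 ^ m" by (simp add: power_mult)
  ultimately show ?thesis by (simp add: GN_seq_def field_simps)
qed

lemma GN_seq_nonneg: "0 \<le> GN_seq k"
  by (simp add: GN_seq_def)

lemma GN_seq_summable_on [simp]: "GN_seq summable_on A"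
proof -
  have "summable (\<lambda>k. 3 * (1 / 2 :: real) ^ k)"
    by (intro summable_mult summable_geometric) auto
  then have "summable GN_seq"
    by (rule summable_comparison_test'[where N = 0]) (simp add: GN_seq_nonneg GN_seq_le)
  then have "GN_seq summable_on UNIV"
    by (simp add: summable_on_UNIV_nonneg_real_iff GN_seq_nonneg)
  then show ?thesis
    using summable_on_subset by blast
qed

lemma GN_seq_shift: "GN_seq (2 * n + k) = GN_seq k / 4 ^ n"
  by (auto simp: GN_seq_def power_add elim!: oddE evenE)

text \<open>The subsum over \<open>A\<close>. As the sequence is absolutely summable, this is the actual sum for
  every \<open>A\<close> and never a default value.\<close>

definition GN_sum :: "nat set \<Rightarrow> real" where
  "GN_sum A = infsum GN_seq A"

lemma has_sum_GN_sum_iff: "(GN_seq has_sum s) A \<longleftrightarrow> s = GN_sum A"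
  unfolding GN_sum_def by (metis GN_seq_summable_on has_sum_infsum infsumI)

lemma GN_E_eq: "GN_E = GN_sum ` {A. A \<subseteq> {1..}}"
  by (auto simp: GN_E_def subsums_def has_sum_GN_sum_iff)

lemma in_GN_U_iff: "s \<in> GN_U \<longleftrightarrow> (\<exists>!A. A \<subseteq> {1..} \<and> s = GN_sum A)"
  unfolding GN_U_def unique_subsums_def subsums_def has_sum_GN_sum_iff by blast

lemma compact_GN_E: "compact GN_E"
  unfolding GN_E_def by (intro compact_subsums GN_seq_summable_on)

lemma GN_sum_Un:
  assumes "A \<inter> B = {}"
  shows "GN_sum (A \<union> B) = GN_sum A + GN_sum B"
  unfolding GN_sum_def using assms by (intro infsum_Un_disjoint) auto

lemma GN_sum_shift: "GN_sum ((+) (2 * n) ` A) = GN_sum A / 4 ^ n"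
proof -
  have "GN_sum ((+) (2 * n) ` A) = (\<Sum>\<^sub>\<infinity>k\<in>A. GN_seq k * (1 / 4 ^ n))"
    unfolding GN_sum_def by (subst infsum_reindex) (auto simp: o_def GN_seq_shift)
  then show ?thesis
    unfolding GN_sum_def infsum_cmult_left' by simp
qed

text \<open>The cylinder of level \<open>n\<close> belonging to \<open>A\<close>: all subsums in which exactly the terms with
  index in \<open>A\<close> are selected among the first \<open>2 n\<close> terms. A level counts pairs of terms, since the
  sequence shifted by two is the original one divided by 4.\<close>

definition GN_cylinder :: "nat \<Rightarrow> nat set \<Rightarrow> real set" where
  "GN_cylinder n A = GN_sum ` {B. B \<subseteq> {1..} \<and> B \<inter> {1..2 * n} = A}"

lemma GN_cylinder_subset: "GN_cylinder n A \<subseteq> GN_E"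
  by (auto simp: GN_cylinder_def GN_E_eq)

lemma GN_E_eq_Union_cylinders: "GN_E = (\<Union>A\<in>Pow {1..2 * n}. GN_cylinder n A)"
  by (auto simp: GN_cylinder_def GN_E_eq)

lemma GN_cylinder_eq_affine_image:
  assumes "A \<subseteq> {1..2 * n}"
  shows "GN_cylinder n A = (\<lambda>t. (1 / 4 ^ n) *\<^sub>R t + GN_sum A) ` GN_E"
proof -
  \<comment> \<open>An index set that begins with \<open>A\<close> is \<open>A\<close> together with an arbitrary index set shifted by
    \<open>2 n\<close>.\<close>
  have "{B. B \<subseteq> {1..} \<and> B \<inter> {1..2 * n} = A} = (\<lambda>C. A \<union> (+) (2 * n) ` C) ` {C. C \<subseteq> {1..}}"
  proof (intro subset_antisym subsetI)
    fix B assume B: "B \<in> {B. B \<subseteq> {1..} \<and> B \<inter> {1..2 * n} = A}"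
    have "B - {1..2 * n} \<subseteq> (+) (2 * n) ` {k. 1 \<le> k \<and> 2 * n + k \<in> B}"
    proof
      fix b assume "b \<in> B - {1..2 * n}"
      then show "b \<in> (+) (2 * n) ` {k. 1 \<le> k \<and> 2 * n + k \<in> B}"
        using B by (intro image_eqI[of _ _ "b - 2 * n"]) auto
    qed
    then have "B = A \<union> (+) (2 * n) ` {k. 1 \<le> k \<and> 2 * n + k \<in> B}"
      using B by auto
    then show "B \<in> (\<lambda>C. A \<union> (+) (2 * n) ` C) ` {C. C \<subseteq> {1..}}"
      by (rule image_eqI) auto
  qed (use assms in force)
  moreover have "GN_sum (A \<union> (+) (2 * n) ` C) = (1 / 4 ^ n) *\<^sub>R GN_sum C + GN_sum A"
    if "C \<subseteq> {1..}" for C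
  proof -
    have "A \<inter> (+) (2 * n) ` C = {}" using assms that by fastforce
    then show ?thesis by (simp add: GN_sum_Un GN_sum_shift)
  qed
  ultimately show ?thesis
    by (simp add: GN_cylinder_def GN_E_eq image_image cong: image_cong_simp)
qed

lemma compact_GN_cylinder:
  assumes "A \<subseteq> {1..2 * n}"
  shows "compact (GN_cylinder n A)"
  unfolding GN_cylinder_eq_affine_image[OF assms]
  by (intro compact_continuous_image compact_GN_E continuous_intros)

lemma measure_GN_cylinder:
  assumes "A \<subseteq> {1..2 * n}"
  shows "measure lebesgue (GN_cylinder n A) = measure lebesgue GN_E / 4 ^ n"
  unfolding GN_cylinder_eq_affine_image[OF assms]
  by (subst measure_lebesgue_affine) (simp add: power_one_over)

lemma open_contains_GN_cylinder:
  assumes "open W" "s \<in> GN_E" "s \<in> W"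
  obtains n A where "A \<subseteq> {1..2 * n}" "GN_cylinder n A \<subseteq> W"
proof -
  obtain e where e: "e > 0" "ball s e \<subseteq> W"
    using assms open_contains_ball by blast
  obtain M where M: "M > 0" "\<And>t. t \<in> GN_E \<Longrightarrow> \<bar>t\<bar> \<le> M"
    using compact_imp_bounded[OF compact_GN_E] by (auto simp: bounded_pos)
  \<comment> \<open>Cylinders of level \<open>n\<close> have diameter at most \<open>2 M / 4\<^sup>n\<close>.\<close>
  obtain n where n: "2 * M / e < 4 ^ n"
    using real_arch_pow[of 4 "2 * M / e"] by auto
  obtain B where B: "B \<subseteq> {1..}" "s = GN_sum B"
    using assms by (auto simp: GN_E_eq)
  define A where "A = B \<inter> {1..2 * n}"
  have A: "A \<subseteq> {1..2 * n}" by (auto simp: A_def)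
  have "s \<in> GN_cylinder n A" using B by (auto simp: GN_cylinder_def A_def)
  then obtain t where t: "t \<in> GN_E" "s = GN_sum A + t / 4 ^ n"
    by (auto simp: GN_cylinder_eq_affine_image[OF A])
  have "GN_cylinder n A \<subseteq> ball s e"
  proof
    fix u assume "u \<in> GN_cylinder n A"
    then obtain v where v: "v \<in> GN_E" "u = GN_sum A + v / 4 ^ n"
      by (auto simp: GN_cylinder_eq_affine_image[OF A])
    have "\<bar>t - v\<bar> \<le> 2 * M" using M(2)[OF t(1)] M(2)[OF v(1)] by linarith
    also have "2 * M < e * 4 ^ n" using n e by (simp add: field_simps)
    finally have "\<bar>(t - v) / 4 ^ n\<bar> < e" by (simp add: abs_divide divide_simps)
    then show "u \<in> ball s e" using t v by (simp add: dist_real_def diff_divide_distrib)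
  qed
  with A e that show thesis by blast
qed

section \<open>The Cantorval has positive measure\<close>

text \<open>Digit by digit in base 4, the residues of the digits 0, 5, 2, 3 supply every integer modulo
  \<open>4\<^sup>n\<close>.\<close>

lemma quaternary_rational_diff_GN_sum_in_Ints:
  "\<exists>A\<subseteq>{1..2 * n}. of_int k / 4 ^ n - GN_sum A \<in> \<int>"
proof (induction n arbitrary: k)
  case 0
  show ?case by (auto simp: GN_sum_def)
next
  case (Suc n)
  have seq: "GN_seq (2 * n + 1) = 3 / 4 ^ Suc n" "GN_seq (2 * n + 2) = 2 / 4 ^ Suc n"
    by (simp_all add: GN_seq_def)
  \<comment> \<open>The last base-4 digit \<open>d\<close> is chosen among 0, 5, 2, 3 so that \<open>k - d\<close> is divisible by 4.\<close>
  have "\<exists>D\<subseteq>{2 * n + 1, 2 * n + 2}. \<exists>d::int. GN_sum D = d / 4 ^ Suc n \<and> k mod 4 = d mod 4"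
  proof -
    have "k mod 4 \<in> {0..<4}" by simp
    also have "{0..<4} = {0, 1, 2, 3 :: int}" by auto
    finally consider "k mod 4 = 0" | "k mod 4 = 1" | "k mod 4 = 2" | "k mod 4 = 3" by auto
    then show ?thesis
    proof cases
      case 1
      then show ?thesis
        by (intro exI[of _ "{}"] conjI exI[of _ 0]) (auto simp: GN_sum_def)
    next
      case 2
      then show ?thesis
        by (intro exI[of _ "{2 * n + 1, 2 * n + 2}"] conjI exI[of _ 5])
          (use seq in \<open>auto simp: GN_sum_def\<close>)
    next
      case 3
      then show ?thesis
        by (intro exI[of _ "{2 * n + 2}"] conjI exI[of _ 2]) (use seq in \<open>auto simp: GN_sum_def\<close>)
    next
      case 4
      then show ?thesis
        by (intro exI[of _ "{2 * n + 1}"] conjI exI[of _ 3]) (use seq in \<open>auto simp: GN_sum_def\<close>)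
    qed
  qed
  then obtain D and d :: int where D: "D \<subseteq> {2 * n + 1, 2 * n + 2}"
    "GN_sum D = d / 4 ^ Suc n" "k mod 4 = d mod 4" by blast
  then obtain k' where k': "k = d + 4 * k'"
    by (metis mod_eqE)
  obtain A where A: "A \<subseteq> {1..2 * n}" "of_int k' / 4 ^ n - GN_sum A \<in> \<int>"
    using Suc.IH by blast
  have "GN_sum (A \<union> D) = GN_sum A + d / 4 ^ Suc n"
    using A D by (subst GN_sum_Un) fastforce+
  then have "of_int k / 4 ^ Suc n - GN_sum (A \<union> D) = of_int k' / 4 ^ n - GN_sum A"
    by (simp add: k' field_simps)
  moreover have "A \<union> D \<subseteq> {1..2 * Suc n}"
    using A D by fastforce
  ultimately show ?case
    using A by metis
qed

lemma GN_E_plus_Ints: "(\<Union>x\<in>GN_E. \<Union>y\<in>\<int>. {x + y}) = UNIV"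
proof -
  let ?S = "(\<Union>x\<in>GN_E. \<Union>y\<in>\<int>. {x + y})"
  have "closed ?S"
    by (intro compact_closed_sums compact_GN_E closed_Ints)
  have "y \<in> ?S" for y
  proof (rule closed_sequentially[OF \<open>closed ?S\<close>])
    fix n
    obtain A where A: "A \<subseteq> {1..2 * n}" "\<lfloor>y * 4 ^ n\<rfloor> / 4 ^ n - GN_sum A \<in> \<int>"
      using quaternary_rational_diff_GN_sum_in_Ints by blast
    then have "A \<subseteq> {1..}" by auto
    then have "GN_sum A \<in> GN_E" by (auto simp: GN_E_eq)
    with A show "\<lfloor>y * 4 ^ n\<rfloor> / 4 ^ n \<in> ?S"
      by (intro UN_I[of "GN_sum A"] UN_I[of "\<lfloor>y * 4 ^ n\<rfloor> / 4 ^ n - GN_sum A"]) auto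
  next
    have "(\<lambda>n. (1 / 4) ^ n) \<longlonglongrightarrow> (0::real)"
      by (intro LIMSEQ_realpow_zero) auto
    moreover have "\<bar>\<lfloor>y * 4 ^ n\<rfloor> / 4 ^ n - y\<bar> \<le> (1 / 4) ^ n" for n
    proof -
      have "\<bar>\<lfloor>y * 4 ^ n\<rfloor> - y * 4 ^ n\<bar> \<le> 1" by linarith
      then have "\<bar>(\<lfloor>y * 4 ^ n\<rfloor> - y * 4 ^ n) / 4 ^ n\<bar> \<le> 1 / 4 ^ n"
        by (simp add: abs_divide divide_right_mono)
      then show ?thesis by (simp add: diff_divide_distrib power_one_over)
    qed
    ultimately have "(\<lambda>n. \<lfloor>y * 4 ^ n\<rfloor> / 4 ^ n - y) \<longlonglongrightarrow> 0"
      by (metis (no_types, lifting) Lim_null_comparison always_eventually real_norm_def)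
    then show "(\<lambda>n. \<lfloor>y * 4 ^ n\<rfloor> / 4 ^ n) \<longlonglongrightarrow> y"
      by (rule LIM_zero_cancel)
  qed
  then show ?thesis by blast
qed

lemma measure_GN_E_pos: "measure lebesgue GN_E > 0"
proof (rule ccontr)
  assume "\<not> ?thesis"
  then have "measure lebesgue GN_E = 0"
    by (simp add: order_less_le)
  then have "negligible GN_E"
    using negligible_iff_measure0[OF lmeasurable_compact[OF compact_GN_E]] by simp
  then have "negligible (\<Union>y\<in>\<int>. (+) y ` GN_E)"
    by (intro negligible_countable_Union) (auto intro: negligible_translation simp: countable_int)
  moreover have "(\<Union>y\<in>\<int>. (+) y ` GN_E) = UNIV"
  proof -
    have "z \<in> (\<Union>y\<in>\<int>. (+) y ` GN_E)" for z
    proof -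
      obtain x y where "x \<in> GN_E" "y \<in> \<int>" "z = x + y"
        using GN_E_plus_Ints by blast
      then show ?thesis by (intro UN_I[of y] image_eqI[of _ _ x]) (simp_all add: add.commute)
    qed
    then show ?thesis by blast
  qed
  ultimately show False by simp
qed

section \<open>Overlaps of cylinders\<close>

text \<open>Equality in the subadditivity of the measure forces the pairwise overlaps to be null: an
  overlap of positive measure would be counted twice on the left-hand side.\<close>

lemma negligible_Int_of_sum_measure_le:
  fixes F :: "'i \<Rightarrow> 'a::euclidean_space set"
  assumes "finite I" and meas: "\<And>i. i \<in> I \<Longrightarrow> F i \<in> lmeasurable"
    and le: "(\<Sum>i\<in>I. measure lebesgue (F i)) \<le> measure lebesgue (\<Union>i\<in>I. F i)"
    and ij: "i \<in> I" "j \<in> I" "i \<noteq> j"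
  shows "negligible (F i \<inter> F j)"
proof -
  define J where "J = I - {i, j}"
  have I: "I = insert i (insert j J)" "finite J" "i \<notin> insert j J" "j \<notin> J"
    using ij \<open>finite I\<close> by (auto simp: J_def)
  have mJ: "(\<Union>k\<in>J. F k) \<in> lmeasurable"
    using I meas by (intro fmeasurable.finite_UN) auto
  have "(\<Union>k\<in>I. F k) = (F i \<union> F j) \<union> (\<Union>k\<in>J. F k)"
    using I by auto
  then have "measure lebesgue (\<Union>k\<in>I. F k) \<le>
      measure lebesgue (F i \<union> F j) + measure lebesgue (\<Union>k\<in>J. F k)"
    using meas ij mJ by (simp add: measure_Un_le fmeasurableD)
  also have "\<dots> \<le> measure lebesgue (F i) + measure lebesgue (F j)
      - measure lebesgue (F i \<inter> F j) + (\<Sum>k\<in>J. measure lebesgue (F k))"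
    using meas ij I
    by (intro add_mono measure_UNION_le) (auto simp: measure_Un3 fmeasurableD)
  also have "\<dots> = (\<Sum>k\<in>I. measure lebesgue (F k)) - measure lebesgue (F i \<inter> F j)"
    using I by simp
  finally have "measure lebesgue (F i \<inter> F j) \<le> 0"
    using le by linarith
  then have "measure lebesgue (F i \<inter> F j) = 0"
    by (simp add: measure_le_0_iff)
  then show ?thesis
    using meas ij by (subst negligible_iff_measure0) (auto intro: fmeasurable.Int)
qed

lemma negligible_Int_GN_cylinders:
  assumes "A \<subseteq> {1..2 * n}" "B \<subseteq> {1..2 * n}" "A \<noteq> B"
  shows "negligible (GN_cylinder n A \<inter> GN_cylinder n B)"
proof (rule negligible_Int_of_sum_measure_le[where I = "Pow {1..2 * n}"])
  have "(\<Sum>C\<in>Pow {1..2 * n}. measure lebesgue (GN_cylinder n C))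
      = (\<Sum>C\<in>Pow {1..2 * n}. measure lebesgue GN_E / 4 ^ n)"
    by (intro sum.cong refl measure_GN_cylinder) auto
  also have "\<dots> = measure lebesgue GN_E"
    by (simp add: card_Pow power_mult)
  finally show "(\<Sum>C\<in>Pow {1..2 * n}. measure lebesgue (GN_cylinder n C))
      \<le> measure lebesgue (\<Union>C\<in>Pow {1..2 * n}. GN_cylinder n C)"
    unfolding GN_E_eq_Union_cylinders[of n, symmetric] by simp
qed (simp_all only: assms Pow_iff lmeasurable_compact compact_GN_cylinder finite_Pow_iff finite_atLeastAtMost not_False_eq_True)

lemma nowhere_dense_Int_GN_cylinders:
  assumes A: "A \<subseteq> {1..2 * n}" and B: "B \<subseteq> {1..2 * n}" and "A \<noteq> B"
  shows "nowhere_dense_in (top_of_set GN_E) (GN_cylinder n A \<inter> GN_cylinder n B)"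
proof -
  define K where "K = GN_cylinder n A \<inter> GN_cylinder n B"
  have sub: "K \<subseteq> GN_E" unfolding K_def using GN_cylinder_subset by blast
  have "closed K"
    unfolding K_def using compact_GN_cylinder[OF A] compact_GN_cylinder[OF B]
    by (intro closed_Int compact_imp_closed)
  then have "closedin (top_of_set GN_E) K"
    using sub by (simp add: closed_subset)
  then have closure: "top_of_set GN_E closure_of K = K"
    by (rule closure_of_closedin)
  have "s \<notin> top_of_set GN_E interior_of K" for s
  proof
    assume "s \<in> top_of_set GN_E interior_of K"
    then obtain W where W: "open W" "s \<in> GN_E" "s \<in> W" "GN_E \<inter> W \<subseteq> K"
      by (auto simp: interior_of_def openin_open)
    obtain m C where C: "C \<subseteq> {1..2 * m}" "GN_cylinder m C \<subseteq> W"
      using open_contains_GN_cylinder[OF W(1-3)] .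
    then have "GN_cylinder m C \<subseteq> K"
      using W(4) GN_cylinder_subset by blast
    then have "negligible (GN_cylinder m C)"
      using negligible_Int_GN_cylinders[OF assms] negligible_subset unfolding K_def by blast
    then show False
      using measure_GN_cylinder[OF C(1)] measure_GN_E_pos
      by (simp add: negligible_imp_measure0)
  qed
  then show ?thesis
    using sub closure by (auto simp: nowhere_dense_in_def simp flip: K_def)
qed

section \<open>Comeagerness of the set of uniqueness\<close>

lemma GN_E_minus_GN_U:
  "GN_E - GN_U = (\<Union>n. \<Union>A\<in>Pow {1..2 * n}. \<Union>B\<in>Pow {1..2 * n} - {A}.
     GN_cylinder n A \<inter> GN_cylinder n B)" (is "_ = ?R")
proof (intro subset_antisym subsetI)
  fix s assume "s \<in> GN_E - GN_U"
  then obtain A B where AB: "A \<subseteq> {1..}" "B \<subseteq> {1..}" "s = GN_sum A" "s = GN_sum B" "A \<noteq> B"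
    unfolding GN_E_eq Diff_iff in_GN_U_iff by blast
  \<comment> \<open>Level \<open>k\<close> suffices to separate \<open>A\<close> and \<open>B\<close> because \<open>1 \<le> k \<le> 2 k\<close>.\<close>
  then obtain k where k: "k \<in> A \<longleftrightarrow> k \<notin> B" by blast
  with AB have "k \<in> {1..2 * k}" by auto
  then have "B \<inter> {1..2 * k} \<noteq> A \<inter> {1..2 * k}" using k by blast
  moreover have "s \<in> GN_cylinder k (A \<inter> {1..2 * k}) \<inter> GN_cylinder k (B \<inter> {1..2 * k})"
    unfolding GN_cylinder_def using AB by blast
  ultimately show "s \<in> ?R"
    by (intro UN_I[of k] UN_I[of "A \<inter> {1..2 * k}"] UN_I[of "B \<inter> {1..2 * k}"]) simp_all
next
  fix s assume "s \<in> ?R"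
  then obtain n A' B' where *: "s \<in> GN_cylinder n A'" "s \<in> GN_cylinder n B'" "A' \<noteq> B'"
    by auto
  from *(1) obtain A where "A \<subseteq> {1..}" "s = GN_sum A" "A \<inter> {1..2 * n} = A'"
    by (auto simp: GN_cylinder_def)
  moreover from *(2) obtain B where "B \<subseteq> {1..}" "s = GN_sum B" "B \<inter> {1..2 * n} = B'"
    by (auto simp: GN_cylinder_def)
  ultimately show "s \<in> GN_E - GN_U"
    unfolding GN_E_eq Diff_iff in_GN_U_iff using *(3) by blast
qed

theorem theorem5p15:
  shows "comeager_in (top_of_set GN_E) GN_U"
proof -
  define \<N> where "\<N> = (\<Union>n. \<Union>A\<in>Pow {1..2 * n}. \<Union>B\<in>Pow {1..2 * n} - {A}.
    {GN_cylinder n A \<inter> GN_cylinder n B})"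
  have "countable \<N>"
    unfolding \<N>_def by (intro countable_UN) (auto intro: countable_finite)
  moreover have "\<forall>N\<in>\<N>. nowhere_dense_in (top_of_set GN_E) N"
    by (auto simp: \<N>_def intro!: nowhere_dense_Int_GN_cylinders)
  moreover have "GN_E - GN_U = \<Union>\<N>"
    unfolding GN_E_minus_GN_U \<N>_def by blast
  moreover have "GN_U \<subseteq> GN_E"
    by (auto simp: GN_U_def GN_E_def unique_subsums_def)
  ultimately show ?thesis
    by (auto simp: comeager_in_def meager_in_def intro!: exI[of _ \<N>])
qed

end
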